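(* Let $D$ be a northeast diagram. Then $\mathcal{P}(D)$ is a refinement of $\mathcal{P}^{ele}(D)$; in particular, $\mathcal{P}(D)$ and $\mathcal{P}^{ele}(D)$ are equal as sets. That is, every diagram that can be obtained from $D$ by a finite sequence of Kohnert moves can also be obtained from $D$ by a finite sequence of elementary Kohnert moves, and every order relation of $\mathcal{P}^{ele}(D)$ is an order relation of $\mathcal{P}(D)$.
   Context: A diagram is a finite subset of $\mathbb{N}\times\mathbb{N}$ ($\mathbb{N}=\{1,2,\dots\}$); an element $(r,c)$ is a cell in row $r$ and column $c$, rows numbered from bottom to top. A position $(r,c)$ is empty if it is not in the diagram. A Kohnert move on a diagram $D$ selects a row $r$, takes the rightmost cell $(r,c)$ of $D$ in that row, and moves it to $(r',c)$, where $r'$ is the largest index $1\le r'<r$ with $(r',c)\notin D$ (if no such $r'$ exists, no move is possible); so the cell may jump over cells of its column. The move is elementary if $r'=r-1$, and a jump move otherwise. The Kohnert poset $\mathcal{P}(D)$ is the set of all diagrams obtainable from $D$ by finitely many Kohnert moves (including $D$), ordered by the transitive closure of $D_2<D_1$ whenever $D_2$ results from $D_1$ by a single Kohnert move. The elementary Kohnert poset $\mathcal{P}^{ele}(D)$ is defined in the same way using only elementary Kohnert moves. A diagram $D$ is northeast if for all cells $(r_1,c_1),(r_2,c_2)\in D$ we have $(\max(r_1,r_2),\max(c_1,c_2))\in D$. *)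

theory Defs
  imports Main
begin

text \<open>A cell is a pair (row, column), with row and column indices starting at 1;
  rows are numbered from bottom to top.\<close>

definition diagram :: "(nat \<times> nat) set \<Rightarrow> bool" where
  "diagram D \<longleftrightarrow> finite D \<and> D \<subseteq> {1..} \<times> {1..}"

definition northeast :: "(nat \<times> nat) set \<Rightarrow> bool" where
  "northeast D \<longleftrightarrow>
     (\<forall>(r1, c1) \<in> D. \<forall>(r2, c2) \<in> D. (max r1 r2, max c1 c2) \<in> D)"

definition rightmost :: "(nat \<times> nat) set \<Rightarrow> nat \<Rightarrow> nat \<Rightarrow> bool" where
  "rightmost D r c \<longleftrightarrow> (r, c) \<in> D \<and> (\<forall>c'. (r, c') \<in> D \<longrightarrow> c' \<le> c)"

definition empty_rows_below :: "(nat \<times> nat) set \<Rightarrow> nat \<Rightarrow> nat \<Rightarrow> nat set" where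
  "empty_rows_below D r c = {r'. 1 \<le> r' \<and> r' < r \<and> (r', c) \<notin> D}"

text \<open>\<open>kohnert_move_at D r c r' D'\<close>: the Kohnert move of \<open>D\<close> at row \<open>r\<close> is possible, takes the
  cell \<open>(r, c)\<close> to \<open>(r', c)\<close>, and results in \<open>D'\<close>.\<close>

definition kohnert_move_at ::
  "(nat \<times> nat) set \<Rightarrow> nat \<Rightarrow> nat \<Rightarrow> nat \<Rightarrow> (nat \<times> nat) set \<Rightarrow> bool" where
  "kohnert_move_at D r c r' D' \<longleftrightarrow>
     rightmost D r c \<and>
     r' \<in> empty_rows_below D r c \<and> (\<forall>s \<in> empty_rows_below D r c. s \<le> r') \<and>
     D' = insert (r', c) (D - {(r, c)})"

definition kohnert_move :: "(nat \<times> nat) set \<Rightarrow> (nat \<times> nat) set \<Rightarrow> bool" where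
  "kohnert_move D D' \<longleftrightarrow> (\<exists>r c r'. kohnert_move_at D r c r' D')"

definition elementary_move :: "(nat \<times> nat) set \<Rightarrow> (nat \<times> nat) set \<Rightarrow> bool" where
  "elementary_move D D' \<longleftrightarrow> (\<exists>r c r'. kohnert_move_at D r c r' D' \<and> r' = r - 1)"

text \<open>A poset is a pair of its ground set and its (reflexive) order relation, with
  \<open>(x, y)\<close> in the relation meaning \<open>x \<le> y\<close>. The poset generated by a move relation below \<open>D\<close>
  is ordered by the transitive closure of \<open>D2 < D1\<close> for moves from \<open>D1\<close> to \<open>D2\<close>,
  together with the diagonal.\<close>

definition move_poset :: "('a \<Rightarrow> 'a \<Rightarrow> bool) \<Rightarrow> 'a \<Rightarrow> 'a set \<times> 'a rel" where
  "move_poset move D =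
     (let P = {E. move\<^sup>*\<^sup>* D E}
      in (P, Id_on P \<union> {(D2, D1). D1 \<in> P \<and> D2 \<in> P \<and> move D1 D2}\<^sup>+))"

definition kohnert_poset ::
  "(nat \<times> nat) set \<Rightarrow> (nat \<times> nat) set set \<times> (nat \<times> nat) set rel" where
  "kohnert_poset D = move_poset kohnert_move D"

definition elementary_kohnert_poset ::
  "(nat \<times> nat) set \<Rightarrow> (nat \<times> nat) set set \<times> (nat \<times> nat) set rel" where
  "elementary_kohnert_poset D = move_poset elementary_move D"

definition refinement_of :: "'a set \<times> 'a rel \<Rightarrow> 'a set \<times> 'a rel \<Rightarrow> bool" where
  "refinement_of P Q \<longleftrightarrow> fst P = fst Q \<and> snd Q \<subseteq> snd P"

text \<open>The relations just defined are indeed partial orders: every move lowers the sum of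
  the row indices.\<close>

lemma kohnert_move_diagram:
  assumes "kohnert_move D D'" and "diagram D"
  shows "diagram D'" and "sum fst D' < sum fst D"
proof -
  obtain r c r' where m: "(r, c) \<in> D" "1 \<le> r'" "r' < r" "(r', c) \<notin> D"
      "D' = insert (r', c) (D - {(r, c)})"
    using assms(1)
    by (auto simp: kohnert_move_def kohnert_move_at_def rightmost_def empty_rows_below_def)
  have fin: "finite D" using assms(2) by (simp add: diagram_def)
  show "diagram D'" using m assms(2) by (auto simp: diagram_def)
  have "sum fst D' = r' + sum fst (D - {(r, c)})" using m fin by simp
  moreover have "sum fst D = r + sum fst (D - {(r, c)})"
    using sum.remove[OF fin m(1), of fst] by simp
  ultimately show "sum fst D' < sum fst D" using m(3) by simp
qed

lemma move_poset_partial_order: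
  assumes sub: "\<And>E F. move E F \<Longrightarrow> kohnert_move E F" and "diagram D"
  shows "partial_order_on (fst (move_poset move D)) (snd (move_poset move D))"
proof -
  define P where "P = {E. move\<^sup>*\<^sup>* D E}"
  define R where "R = {(D2, D1). D1 \<in> P \<and> D2 \<in> P \<and> move D1 D2}"
  have diag: "diagram E" if "move\<^sup>*\<^sup>* D E" for E
    using that assms by induction (auto intro: kohnert_move_diagram(1))
  have "R \<subseteq> measure (sum fst)"
    using diag by (auto simp: R_def P_def intro!: kohnert_move_diagram(2) sub)
  moreover have "trans (measure (sum fst :: (nat \<times> nat) set \<Rightarrow> nat))"
    by (auto simp: trans_def)
  ultimately have lt: "R\<^sup>+ \<subseteq> measure (sum fst)"
    by (metis trancl_id trancl_mono subrelI)
  have field: "R\<^sup>+ \<subseteq> P \<times> P"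
    by (rule trancl_subset_Sigma) (auto simp: R_def)
  have "partial_order_on P (Id_on P \<union> R\<^sup>+)"
    unfolding partial_order_on_def preorder_on_def
  proof (intro conjI)
    show "refl_on P (Id_on P \<union> R\<^sup>+)" by (auto simp: refl_on_def)
    show "Id_on P \<union> R\<^sup>+ \<subseteq> P \<times> P" using field by auto
    show "trans (Id_on P \<union> R\<^sup>+)"
      by (auto simp: trans_def intro: trancl_trans)
    show "antisym (Id_on P \<union> R\<^sup>+)"
    proof (rule antisymI)
      fix x y assume xy: "(x, y) \<in> Id_on P \<union> R\<^sup>+" "(y, x) \<in> Id_on P \<union> R\<^sup>+"
      show "x = y"
      proof (rule ccontr)
        assume "x \<noteq> y"
        with xy have "(x, y) \<in> R\<^sup>+" "(y, x) \<in> R\<^sup>+" by auto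
        with lt have "(x, y) \<in> measure (sum fst)" "(y, x) \<in> measure (sum fst)" by blast+
        thus False by simp
      qed
    qed
  qed
  thus ?thesis by (simp add: move_poset_def Let_def P_def R_def)
qed

lemma kohnert_poset_partial_order:
  "diagram D \<Longrightarrow> partial_order_on (fst (kohnert_poset D)) (snd (kohnert_poset D))"
  unfolding kohnert_poset_def by (rule move_poset_partial_order)

lemma elementary_kohnert_poset_partial_order:
  "diagram D \<Longrightarrow>
     partial_order_on (fst (elementary_kohnert_poset D)) (snd (elementary_kohnert_poset D))"
  unfolding elementary_kohnert_poset_def
  by (rule move_poset_partial_order) (auto simp: kohnert_move_def elementary_move_def)

end

theory Submission
  imports Defs
begin

text \<open>Cells of a column never need to be permuted, so a diagram below a northeast \<open>D\<close> can be
  described by the row \<open>p l c\<close> to which each cell \<open>(l, c)\<close> of \<open>D\<close> has sunk: strictly increasing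
  along columns, with \<open>p l c \<le> l\<close>, and weakly decreasing to the right within a row of \<open>D\<close>.
  All Kohnert moves preserve these conditions when a jump is read as shifting down by one a whole
  block of cells of its column. Conversely, if some cell has sunk, then the leftmost among the
  highest currently placed sunken cells can be raised by one, and this undoes an elementary move.\<close>

section \<open>Diagrams encoded by sinking functions\<close>

definition sinking :: "(nat \<times> nat) set \<Rightarrow> (nat \<Rightarrow> nat \<Rightarrow> nat) \<Rightarrow> bool" where
  "sinking D p \<longleftrightarrow>
     (\<forall>l c. (l, c) \<in> D \<longrightarrow> 1 \<le> p l c \<and> p l c \<le> l) \<and>
     (\<forall>l m c. (l, c) \<in> D \<longrightarrow> (m, c) \<in> D \<longrightarrow> l < m \<longrightarrow> p l c < p m c) \<and>
     (\<forall>l c c'. (l, c) \<in> D \<longrightarrow> (l, c') \<in> D \<longrightarrow> c < c' \<longrightarrow> p l c' \<le> p l c)"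

definition sunk :: "(nat \<times> nat) set \<Rightarrow> (nat \<Rightarrow> nat \<Rightarrow> nat) \<Rightarrow> (nat \<times> nat) set" where
  "sunk D p = {(p l c, c) |l c. (l, c) \<in> D}"

lemma northeastD:
  assumes "northeast D" "(l, c) \<in> D" "(m, d) \<in> D"
  shows "(max l m, max c d) \<in> D"
  using assms unfolding northeast_def by fast

lemma sinking_bounds: "sinking D p \<Longrightarrow> (l, c) \<in> D \<Longrightarrow> 1 \<le> p l c \<and> p l c \<le> l"
  and sinking_column: "sinking D p \<Longrightarrow> (l, c) \<in> D \<Longrightarrow> (m, c) \<in> D \<Longrightarrow> l < m \<Longrightarrow> p l c < p m c"
  and sinking_row: "sinking D p \<Longrightarrow> (l, c) \<in> D \<Longrightarrow> (l, c') \<in> D \<Longrightarrow> c < c' \<Longrightarrow> p l c' \<le> p l c"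
  unfolding sinking_def by blast+

lemma sinking_column_iff:
  assumes "sinking D p" "(l, c) \<in> D" "(m, c) \<in> D"
  shows "p l c < p m c \<longleftrightarrow> l < m"
  using sinking_column[OF assms] sinking_column[OF assms(1,3,2)] by (cases l m rule: linorder_cases) auto

lemma sunkI: "(l, c) \<in> D \<Longrightarrow> (p l c, c) \<in> sunk D p"
  unfolding sunk_def by blast

lemma sunkE:
  assumes "(s, c) \<in> sunk D p"
  obtains l where "(l, c) \<in> D" "p l c = s"
  using assms unfolding sunk_def by blast

lemma sinking_id:
  assumes "diagram D"
  shows "sinking D (\<lambda>l c. l)" and "sunk D (\<lambda>l c. l) = D"
  using assms by (auto simp: sinking_def sunk_def diagram_def)

section \<open>Closure under Kohnert moves\<close>

text \<open>A jump from \<open>r\<close> to \<open>t\<close> crosses only occupied positions, so it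
  yields the same diagram as lowering by one every cell of column \<open>c\<close> now in rows
  \<open>t + 1\<close> to \<open>r\<close>. The row condition survives because \<open>D\<close> is
  northeast.\<close>

lemma sinking_kohnert_move:
  assumes ne: "northeast D" and p: "sinking D p" and move: "kohnert_move (sunk D p) E"
  shows "\<exists>q. sinking D q \<and> E = sunk D q"
proof -
  obtain r c t where m: "kohnert_move_at (sunk D p) r c t E"
    using move unfolding kohnert_move_def by blast
  have rc: "(r, c) \<in> sunk D p" and right: "\<And>d. (r, d) \<in> sunk D p \<Longrightarrow> d \<le> c"
    and t: "1 \<le> t" "t < r" "(t, c) \<notin> sunk D p"
    and E: "E = insert (t, c) (sunk D p - {(r, c)})"
    using m by (auto simp: kohnert_move_at_def rightmost_def empty_rows_below_def)
  have full: "(s, c) \<in> sunk D p" if "t < s" "s \<le> r" for s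
  proof (cases "s = r")
    case False
    show ?thesis
    proof (rule ccontr)
      assume "(s, c) \<notin> sunk D p"
      with False that t(1) have "s \<in> empty_rows_below (sunk D p) r c"
        by (auto simp: empty_rows_below_def)
      with m have "s \<le> t" unfolding kohnert_move_at_def by blast
      with that show False by simp
    qed
  qed (use rc in simp)
  \<comment> \<open>The whole block shifts down by one; an elementary move is the case where the
    block is a single cell.\<close>
  define q where "q = (\<lambda>l d. if d = c \<and> t < p l c \<and> p l c \<le> r then p l c - 1 else p l d)"
  have ne_t: "p l c \<noteq> t" if "(l, c) \<in> D" for l
    using that t(3) sunkI by metis
  \<comment> \<open>Slack for lowering the block, by descent from its top. In row \<open>r\<close>
    the slack comes from \<open>(r, c)\<close> being rightmost. Below that, the block cell
    \<open>(k, c)\<close> sits one row higher, northeastness puts \<open>(k, c')\<close> in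
    \<open>D\<close>, and \<open>p l c' < p k c' < p k c = p l c + 1\<close>.\<close>
  have free: "p l c' < p l c"
    if "(l, c) \<in> D" "(l, c') \<in> D" "c < c'" "t < p l c" "p l c \<le> r" for l c'
    using that
  proof (induction "r - p l c" arbitrary: l)
    case 0
    then have "p l c = r" by simp
    moreover have "p l c' \<noteq> r"
      using right[of c'] sunkI[OF \<open>(l, c') \<in> D\<close>, of p] \<open>c < c'\<close> by auto
    moreover have "p l c' \<le> p l c" using sinking_row[OF p] 0 by blast
    ultimately show ?case by simp
  next
    case (Suc x)
    then have "(Suc (p l c), c) \<in> sunk D p" by (intro full) auto
    then obtain k where k: "(k, c) \<in> D" "p k c = Suc (p l c)" by (rule sunkE)
    have "l < k" using sinking_column_iff[OF p \<open>(l, c) \<in> D\<close> k(1)] k(2) by simp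
    have k': "(k, c') \<in> D"
      using northeastD[OF ne k(1) \<open>(l, c') \<in> D\<close>] \<open>l < k\<close> \<open>c < c'\<close> by (simp add: max_def)
    have "p k c' < p k c" using Suc k k' by (intro Suc.hyps(1)) auto
    moreover have "p l c' < p k c'" using sinking_column[OF p] Suc.prems k' \<open>l < k\<close> by blast
    ultimately show ?case using k(2) by simp
  qed
  have "sinking D q"
    unfolding sinking_def
  proof (intro conjI allI impI)
    fix l d assume "(l, d) \<in> D"
    then show "1 \<le> q l d" "q l d \<le> l"
      using sinking_bounds[OF p, of l d] t(1) by (auto simp: q_def)
  next
    fix l k d assume ld: "(l, d) \<in> D" "(k, d) \<in> D" "l < k"
    then have "p l d < p k d" using sinking_column[OF p] by blast
    \<comment> \<open>The critical case has only the upper cell lowered: then \<open>p l c\<close>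
      is at most \<open>t\<close>, and it differs from \<open>t\<close> because
      \<open>(t, c)\<close> is empty.\<close>
    then show "q l d < q k d"
      using ne_t[of l] ld by (auto simp: q_def)
  next
    fix l d d' assume ld: "(l, d) \<in> D" "(l, d') \<in> D" "d < d'"
    then have "p l d' \<le> p l d" using sinking_row[OF p] by blast
    then show "q l d' \<le> q l d"
      using free[of l d'] ld by (auto simp: q_def)
  qed
  moreover have "E = sunk D q"
  proof (intro set_eqI iffI)
    fix z assume "z \<in> E"
    obtain s d where z: "z = (s, d)" by (cases z)
    consider "s = t" "d = c" | "(s, d) \<in> sunk D p" "(s, d) \<noteq> (r, c)"
      using \<open>z \<in> E\<close> z E by auto
    then show "z \<in> sunk D q"
    proof cases
      case 1
      \<comment> \<open>The landing position is filled by the lowest cell of the block.\<close>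
      obtain l where "(l, c) \<in> D" "p l c = Suc t" using full[of "Suc t"] t(2) by (auto elim: sunkE)
      then show ?thesis using sunkI[of l c D q] z 1 t(2) by (auto simp: q_def)
    next
      case 2
      show ?thesis
      \<comment> \<open>A position crossed by the jump is refilled by the block cell directly above
        it.\<close>
      proof (cases "d = c \<and> t < s \<and> s < r")
        case True
        then obtain l where "(l, c) \<in> D" "p l c = Suc s" using full[of "Suc s"] by (auto elim: sunkE)
        then show ?thesis using sunkI[of l c D q] z True by (auto simp: q_def)
      next
        case False
        obtain l where "(l, d) \<in> D" "p l d = s" using 2(1) by (rule sunkE)
        moreover have "q l d = p l d" using calculation False 2(2) by (auto simp: q_def)
        ultimately show ?thesis using sunkI[of l d D q] z by simp
      qed
    qed
  next
    fix z assume "z \<in> sunk D q"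
    then obtain l d where z: "z = (q l d, d)" "(l, d) \<in> D" unfolding sunk_def by blast
    show "z \<in> E"
    proof (cases "d = c \<and> t < p l c \<and> p l c \<le> r")
      case True
      then have "q l d = p l c - 1" by (simp add: q_def)
      then show ?thesis using True z full[of "p l c - 1"] unfolding E by auto
    next
      case False
      then have q: "q l d = p l d" by (auto simp: q_def)
      have "(p l d, d) \<noteq> (r, c)" using False t(2) by auto
      then show ?thesis using q z sunkI[OF z(2), of p] unfolding E by auto
    qed
  qed
  ultimately show ?thesis by blast
qed

section \<open>Undoing elementary moves\<close>

text \<open>Let \<open>x\<close> be the highest current row of a sunken cell and \<open>c\<close>
  the leftmost column of such a cell in row \<open>x\<close>. Row \<open>x + 1\<close> is then empty
  from column \<open>c\<close> rightwards, so the cell fits there and is rightmost there; lowering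
  it again is elementary.\<close>

lemma sinking_raise:
  assumes ne: "northeast D" and p: "sinking D p" and fin: "finite D"
    and moved: "(l\<^sub>0, c\<^sub>0) \<in> D" "p l\<^sub>0 c\<^sub>0 < l\<^sub>0"
  obtains l c where "(l, c) \<in> D" "p l c < l" "sinking D (p(l := (p l)(c := Suc (p l c))))"
    "elementary_move (sunk D (p(l := (p l)(c := Suc (p l c))))) (sunk D p)"
proof -
  define M where "M = {(l, c) \<in> D. p l c < l}"
  have finM: "finite M" and "M \<noteq> {}"
    using fin moved unfolding M_def by (auto intro: rev_finite_subset)
  define x where "x = Max ((\<lambda>(l, c). p l c) ` M)"
  have x_in: "x \<in> (\<lambda>(l, c). p l c) ` M"
    unfolding x_def using finM \<open>M \<noteq> {}\<close> by (intro Max_in) auto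
  have x_max: "p k d \<le> x" if "(k, d) \<in> D" "p k d < k" for k d
    unfolding x_def using finM that by (intro Max_ge) (auto simp: M_def image_iff)
  define c where "c = (LEAST c. \<exists>l. (l, c) \<in> M \<and> p l c = x)"
  have "\<exists>l. (l, c) \<in> M \<and> p l c = x"
    unfolding c_def by (rule LeastI_ex) (use x_in in auto)
  then obtain l where l: "(l, c) \<in> D" "x < l" "p l c = x" by (auto simp: M_def)
  have c_min: "c \<le> d" if "(k, d) \<in> D" "p k d < k" "p k d = x" for k d
    unfolding c_def by (rule Least_le) (use that in \<open>auto simp: M_def\<close>)
  \<comment> \<open>By maximality of \<open>x\<close>, a cell placed in row \<open>x + 1\<close> has
    not sunk.\<close>
  have above: "k = Suc x" if "(k, d) \<in> D" "p k d = Suc x" for k d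
    using x_max[OF that(1)] sinking_bounds[OF p that(1)] that(2) by linarith
  \<comment> \<open>An unsunken cell there would have a cell \<open>(l, d)\<close> of
    \<open>D\<close> in or above its row, by northeastness. The row condition gives
    \<open>p l d \<le> x\<close>, the column condition \<open>p l d \<ge> x + 1\<close>. The case
    \<open>d = c\<close> frees the target; \<open>d > c\<close> makes the raised cell
    rightmost.\<close>
  have empty: "(Suc x, d) \<notin> sunk D p" if "c \<le> d" for d
  proof
    assume "(Suc x, d) \<in> sunk D p"
    then obtain k where k: "(k, d) \<in> D" "p k d = Suc x" by (rule sunkE)
    then have "k = Suc x" by (rule above)
    with l(2) have "k \<le> l" by simp
    then have ld: "(l, d) \<in> D"
      using northeastD[OF ne l(1) k(1)] that by (simp add: max_def split: if_splits)
    have "p l d \<le> x" using sinking_row[OF p l(1) ld] that l(3) by (cases "c = d") auto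
    moreover have "p k d \<le> p l d"
      using sinking_column[OF p k(1) ld] \<open>k \<le> l\<close> by (cases "k = l") auto
    ultimately show False using k(2) by simp
  qed
  define q where "q = p(l := (p l)(c := Suc (p l c)))"
  have q: "q k d = (if k = l \<and> d = c then Suc x else p k d)" for k d
    using l(3) by (auto simp: q_def)
  have "sinking D q"
    unfolding sinking_def
  proof (intro conjI allI impI)
    fix k d assume "(k, d) \<in> D"
    then show "1 \<le> q k d" "q k d \<le> k"
      using sinking_bounds[OF p, of k d] l(2) by (auto simp: q)
  next
    fix k m d assume kd: "(k, d) \<in> D" "(m, d) \<in> D" "k < m"
    then have "p k d < p m d" using sinking_column[OF p] by blast
    moreover have "p m c \<noteq> Suc x" if "d = c" using empty[of c] sunkI[OF kd(2), of p] that by auto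
    ultimately show "q k d < q m d" using l(3) by (auto simp: q)
  next
    fix k d d' assume kd: "(k, d) \<in> D" "(k, d') \<in> D" "d < d'"
    then have "p k d' \<le> p k d" using sinking_row[OF p] by blast
    \<comment> \<open>Raising \<open>(l, c)\<close> could only violate the bound by a cell of the
      same row further left that is also at \<open>x\<close>; the choice of \<open>c\<close>
      excludes it.\<close>
    moreover have "p l d \<noteq> x" if "k = l" "d' = c"
      using c_min[of l d] that kd l(2) by auto
    ultimately show "q k d' \<le> q k d" using l(3) by (auto simp: q)
  qed
  have others: "p k c \<noteq> x" if "(k, c) \<in> D" "k \<noteq> l" for k
    using sinking_column[OF p that(1) l(1)] sinking_column[OF p l(1) that(1)] l(3) that(2)
    by (cases k l rule: linorder_cases) auto
  have sunk_q: "sunk D q = insert (Suc x, c) (sunk D p - {(x, c)})"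
  proof (intro set_eqI iffI)
    fix z assume "z \<in> sunk D q"
    then obtain k d where "z = (q k d, d)" "(k, d) \<in> D" unfolding sunk_def by blast
    then show "z \<in> insert (Suc x, c) (sunk D p - {(x, c)})"
      using others[of k] sunkI[of k d D p] by (auto simp: q)
  next
    fix z assume z: "z \<in> insert (Suc x, c) (sunk D p - {(x, c)})"
    show "z \<in> sunk D q"
    proof (cases "z = (Suc x, c)")
      case True
      then show ?thesis using sunkI[OF l(1), of q] by (simp add: q)
    next
      case False
      then obtain k d where "z = (p k d, d)" "(k, d) \<in> D" "z \<noteq> (x, c)"
        using z unfolding sunk_def by blast
      then show ?thesis using sunkI[of k d D q] l(3) by (auto simp: q split: if_splits)
    qed
  qed
  have "1 \<le> x" using sinking_bounds[OF p l(1)] l(3) by simp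
  have "rightmost (sunk D q) (Suc x) c"
    unfolding rightmost_def sunk_q using empty by (auto intro: leI less_imp_le)
  moreover have "sunk D p = insert (x, c) (sunk D q - {(Suc x, c)})"
    unfolding sunk_q using empty[of c] sunkI[OF l(1), of p] l(3) by auto
  ultimately have "kohnert_move_at (sunk D q) (Suc x) c x (sunk D p)"
    using \<open>1 \<le> x\<close> unfolding kohnert_move_at_def empty_rows_below_def sunk_q by auto
  then have "elementary_move (sunk D q) (sunk D p)"
    unfolding elementary_move_def by fastforce
  with \<open>sinking D q\<close> show thesis using that[OF l(1)] l(2,3) unfolding q_def by simp
qed

text \<open>Induction on the total depth sunk. Raising a cell lowers this depth and is undone by one
  elementary move, which is appended to the path; depth zero means \<open>D\<close> itself.\<close>

lemma sinking_elementary_reachable: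
  assumes "northeast D" "diagram D" "sinking D p"
  shows "elementary_move\<^sup>*\<^sup>* D (sunk D p)"
  using assms(3)
proof (induction "\<Sum>(l, c) \<in> D. l - p l c" arbitrary: p rule: less_induct)
  case less
  have fin: "finite D" using assms(2) by (simp add: diagram_def)
  show ?case
  proof (cases "\<exists>l c. (l, c) \<in> D \<and> p l c < l")
    case True
    then obtain l\<^sub>0 c\<^sub>0 where moved: "(l\<^sub>0, c\<^sub>0) \<in> D" "p l\<^sub>0 c\<^sub>0 < l\<^sub>0" by blast
    obtain l c q where l: "(l, c) \<in> D" "p l c < l" and q_def: "q = p(l := (p l)(c := Suc (p l c)))"
      and q: "sinking D q" "elementary_move (sunk D q) (sunk D p)"
      using sinking_raise[OF assms(1) less.prems fin moved] by metis
    have "(\<Sum>(l, c) \<in> D. l - q l c) < (\<Sum>(l, c) \<in> D. l - p l c)"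
      using fin
    proof (rule sum_strict_mono_ex1)
      \<comment> \<open>The truncated difference really drops at the raised cell, since
        \<open>p l c < l\<close>.\<close>
      show "\<exists>z\<in>D. (case z of (l, c) \<Rightarrow> l - q l c) < (case z of (l, c) \<Rightarrow> l - p l c)"
        using l by (intro bexI[of _ "(l, c)"]) (auto simp: q_def)
    qed (auto simp: q_def)
    then have "elementary_move\<^sup>*\<^sup>* D (sunk D q)" using less.hyps q(1) by blast
    then show ?thesis using q(2) by (rule rtranclp.rtrancl_into_rtrancl)
  next
    case False
    then have "p l c = l" if "(l, c) \<in> D" for l c
      using sinking_bounds[OF less.prems that] that by (meson le_neq_implies_less)
    then have "sunk D p = sunk D (\<lambda>l c. l)" unfolding sunk_def by force
    then show ?thesis using sinking_id(2)[OF assms(2)] by simp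
  qed
qed

section \<open>Comparison of the two posets\<close>

lemma kohnert_reachable_sinking:
  assumes "northeast D" "diagram D" "kohnert_move\<^sup>*\<^sup>* D E"
  shows "\<exists>p. sinking D p \<and> E = sunk D p"
  using assms(3)
proof induction
  case base
  show ?case using sinking_id[OF assms(2)] by metis
next
  case (step E F)
  then show ?case using sinking_kohnert_move[OF assms(1)] by blast
qed

theorem theorem1p2:
  fixes D :: "(nat \<times> nat) set"
  assumes "diagram D" and "northeast D"
  shows "refinement_of (kohnert_poset D) (elementary_kohnert_poset D) \<and>
         fst (kohnert_poset D) = fst (elementary_kohnert_poset D) \<and>
         (\<forall>E. kohnert_move\<^sup>*\<^sup>* D E \<longrightarrow> elementary_move\<^sup>*\<^sup>* D E) \<and>
         snd (elementary_kohnert_poset D) \<subseteq> snd (kohnert_poset D)"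
proof -
  have sub: "kohnert_move E F" if "elementary_move E F" for E F
    using that unfolding elementary_move_def kohnert_move_def by blast
  have ele: "elementary_move\<^sup>*\<^sup>* D E" if "kohnert_move\<^sup>*\<^sup>* D E" for E
    using kohnert_reachable_sinking[OF assms(2,1) that]
      sinking_elementary_reachable[OF assms(2,1)] by blast
  have koh: "kohnert_move\<^sup>*\<^sup>* D E" if "elementary_move\<^sup>*\<^sup>* D E" for E
    using that sub mono_rtranclp[of elementary_move kohnert_move] by blast
  have ground: "{E. kohnert_move\<^sup>*\<^sup>* D E} = {E. elementary_move\<^sup>*\<^sup>* D E}"
    using ele koh by blast
  have fst_eq: "fst (kohnert_poset D) = fst (elementary_kohnert_poset D)"
    using ground by (simp add: kohnert_poset_def elementary_kohnert_poset_def move_poset_def Let_def)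
  \<comment> \<open>With equal ground sets, the diagonals agree and every elementary generating pair
    is a Kohnert one; transitive closure preserves the inclusion.\<close>
  have snd_sub: "snd (elementary_kohnert_poset D) \<subseteq> snd (kohnert_poset D)"
    unfolding kohnert_poset_def elementary_kohnert_poset_def move_poset_def Let_def snd_conv
    using ele koh sub by (intro Un_mono trancl_mono_subset) auto
  show ?thesis using ele fst_eq snd_sub by (simp add: refinement_of_def)
qed

end
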